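(* For every integer $\Delta\geq 3$, the tree $T_\Delta$ (defined in the context) satisfies $h(T_\Delta)=\Delta+2$.
   Context: All graphs are finite and simple. A harmonious coloring of a graph $G$ is a proper vertex coloring of $G$ such that every (unordered) pair of colors appears on at most one pair of adjacent vertices; that is, for any two distinct edges $xy$ and $x'y'$ of $G$, the sets of colors of their endpoints are different. The harmonious chromatic number $h(G)$ is the minimum number of colors needed for a harmonious coloring of $G$. A leaf is a vertex of degree $1$. For an integer $\Delta\geq 3$, the tree $T_\Delta$ is obtained from a $4$-vertex path $(v_1,v_2,v_3,v_4)$ (with edges $v_1v_2$, $v_2v_3$, $v_3v_4$) by adding $\Delta-1$ new leaves adjacent to $v_1$, $\Delta-2$ new leaves adjacent to $v_2$, and $\Delta-2$ new leaves adjacent to $v_4$ (all added leaves being distinct). *)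

theory Defs
  imports "Graph_Theory.Pair_Digraph"
begin

text \<open>
  A finite simple graph is a \<open>pair_graph\<close>: finite vertex set, and a symmetric irreflexive set
  of arcs. An undirected edge \<open>xy\<close> is the pair of arcs \<open>(x, y)\<close>, \<open>(y, x)\<close>, so two edges are
  distinct iff their endpoint sets are.
\<close>

definition proper_coloring :: "'a pair_pre_digraph \<Rightarrow> ('a \<Rightarrow> 'c) \<Rightarrow> bool" where
  "proper_coloring G c \<longleftrightarrow> (\<forall>(x, y) \<in> parcs G. c x \<noteq> c y)"

definition harmonious_coloring :: "'a pair_pre_digraph \<Rightarrow> ('a \<Rightarrow> 'c) \<Rightarrow> bool" where
  "harmonious_coloring G c \<longleftrightarrow>
     proper_coloring G c \<and>
     (\<forall>(x, y) \<in> parcs G. \<forall>(x', y') \<in> parcs G. {x, y} \<noteq> {x', y'} \<longrightarrow> {c x, c y} \<noteq> {c x', c y'})"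

text \<open>Well defined on finite simple graphs by \<open>harmonious_coloring_exists\<close> below.\<close>

definition harmonious_chromatic_number :: "'a pair_pre_digraph \<Rightarrow> nat" where
  "harmonious_chromatic_number G =
     (LEAST k. \<exists>c :: 'a \<Rightarrow> nat. c ` pverts G \<subseteq> {..<k} \<and> harmonious_coloring G c)"

lemma (in pair_graph) harmonious_coloring_exists:
  "\<exists>k. \<exists>c :: 'a \<Rightarrow> nat. c ` pverts G \<subseteq> {..<k} \<and> harmonious_coloring G c"
proof -
  obtain c :: "'a \<Rightarrow> nat" and n where c: "c ` pverts G = {i. i < n}" "inj_on c (pverts G)"
    using finite_imp_inj_to_nat_seg[OF pair_finite_verts] by blast
  have "c x \<noteq> c y" if "(x, y) \<in> parcs G" for x y
    using inj_on_eq_iff[OF c(2) in_arcsD1[OF that] in_arcsD2[OF that]] no_loops'[OF that] by simp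
  moreover have "{c x, c y} \<noteq> {c x', c y'}"
    if "(x, y) \<in> parcs G" "(x', y') \<in> parcs G" "{x, y} \<noteq> {x', y'}" for x y x' y'
    using inj_on_image_eq_iff[OF c(2), of "{x, y}" "{x', y'}"] that(3) in_arcsD1[OF that(1)] in_arcsD2[OF that(1)] in_arcsD1[OF that(2)] in_arcsD2[OF that(2)] by simp
  ultimately have "harmonious_coloring G c"
    unfolding harmonious_coloring_def proper_coloring_def by blast
  with c(1) show ?thesis by blast
qed

text \<open>\<open>Spine i\<close> is the path vertex \<open>v\<^sub>i\<close>; \<open>Leaf i j\<close> is the \<open>j\<close>-th leaf added at \<open>v\<^sub>i\<close>.\<close>

datatype tree_vertex = Spine nat | Leaf nat nat

definition num_leaves :: "nat \<Rightarrow> nat \<Rightarrow> nat" where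
  "num_leaves \<Delta> i = (if i = 1 then \<Delta> - 1 else if i = 2 \<or> i = 4 then \<Delta> - 2 else 0)"

definition tree_T :: "nat \<Rightarrow> tree_vertex pair_pre_digraph" where
  "tree_T \<Delta> =
     (let E = {(Spine 1, Spine 2), (Spine 2, Spine 3), (Spine 3, Spine 4)}
              \<union> {(Spine i, Leaf i j) | i j. i \<in> {1..4} \<and> j < num_leaves \<Delta> i}
      in \<lparr> pverts = Spine ` {1..4} \<union> {Leaf i j | i j. i \<in> {1..4} \<and> j < num_leaves \<Delta> i},
           parcs = E \<union> E\<inverse> \<rparr>)"

lemma pair_graph_tree_T: "pair_graph (tree_T \<Delta>)"
proof -
  have "pverts (tree_T \<Delta>) =
      Spine ` {1..4} \<union> (\<lambda>(i, j). Leaf i j) ` (SIGMA i:{1..4}. {..<num_leaves \<Delta> i})"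
    by (auto simp: tree_T_def Let_def)
  then have "finite (pverts (tree_T \<Delta>))"
    by simp
  moreover have wf: "parcs (tree_T \<Delta>) \<subseteq> pverts (tree_T \<Delta>) \<times> pverts (tree_T \<Delta>)"
    by (auto simp: tree_T_def Let_def)
  ultimately have "finite (parcs (tree_T \<Delta>))"
    by (meson finite_SigmaI finite_subset)
  moreover have "sym (parcs (tree_T \<Delta>))"
    by (auto simp: tree_T_def Let_def sym_def)
  moreover have "fst e \<noteq> snd e" if "e \<in> parcs (tree_T \<Delta>)" for e
    using that by (auto simp: tree_T_def Let_def)
  ultimately show ?thesis
    using wf \<open>finite (pverts (tree_T \<Delta>))\<close>
    by unfold_locales (auto simp: symmetric_def)
qed

end

theory Submission
  imports Defs
begin

text \<open>
  Lower bound. The neighbours of a vertex \<open>x\<close> receive distinct colours different from that of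
  \<open>x\<close>. So if there are only \<open>deg x + 1\<close> colours, then every pair of colours containing that of \<open>x\<close>
  already occurs on an edge at \<open>x\<close>, and no edge avoiding \<open>x\<close> can have an end coloured like \<open>x\<close>
  (\<open>saturated_vertex_incident\<close>). With \<open>\<Delta> + 1\<close> colours this applies to \<open>v\<^sub>1\<close> and to \<open>v\<^sub>2\<close>, both of
  degree \<open>\<Delta>\<close>, and neither is incident with an edge at \<open>v\<^sub>4\<close>. Hence the \<open>\<Delta> - 1\<close> neighbours
  of \<open>v\<^sub>4\<close> must have distinct colours outside those of \<open>v\<^sub>1\<close>, \<open>v\<^sub>2\<close>, \<open>v\<^sub>4\<close>, which are themselves
  three distinct colours; only \<open>\<Delta> - 2\<close> colours remain.

  Upper bound. Every edge meets one of \<open>v\<^sub>1\<close>, \<open>v\<^sub>2\<close>, \<open>v\<^sub>4\<close>. If these get the three smallest colours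
  and those of \<open>v\<^sub>1\<close> and \<open>v\<^sub>2\<close> are not used again, then two edges can share a pair of
  colours only if they meet in one of these vertices, so it suffices that neighbours of the same
  vertex differ. With \<open>\<Delta> + 2\<close> colours, \<open>\<Delta> - 1\<close> are left for the \<open>\<Delta> - 1\<close> neighbours of \<open>v\<^sub>4\<close>
  (\<open>tree_T_coloring\<close>).
\<close>

section \<open>Colours around a vertex\<close>

lemma harmonious_coloringD:
  assumes "harmonious_coloring G c" "(x, y) \<in> parcs G" "(x', y') \<in> parcs G"
    and "{c x, c y} = {c x', c y'}"
  shows "{x, y} = {x', y'}"
  using assms unfolding harmonious_coloring_def by blast

lemma harmonious_coloring_proper:
  "harmonious_coloring G c \<Longrightarrow> (x, y) \<in> parcs G \<Longrightarrow> c x \<noteq> c y"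
  unfolding harmonious_coloring_def proper_coloring_def by blast

lemma harmonious_inj_on_neighbours:
  assumes "harmonious_coloring G c"
  shows "inj_on c {y. (x, y) \<in> parcs G}"
proof (rule inj_onI)
  fix y z assume "y \<in> {y. (x, y) \<in> parcs G}" "z \<in> {y. (x, y) \<in> parcs G}" "c y = c z"
  then have "{x, y} = {x, z}"
    using harmonious_coloringD[OF assms, of x y x z] by simp
  then show "y = z" by (auto simp: doubleton_eq_iff)
qed

text \<open>
  The neighbours of \<open>x\<close> use all colours but that of \<open>x\<close>, so the colour pair of \<open>uv\<close> is also that
  of some edge at \<open>x\<close>, and harmony makes the two edges equal.
\<close>

lemma (in pair_graph) saturated_vertex_incident:
  assumes harm: "harmonious_coloring G c"
    and C: "finite C" "c ` pverts G \<subseteq> C" "card C = Suc (card {y. (x, y) \<in> parcs G})"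
    and x: "x \<in> pverts G"
    and uv: "(u, v) \<in> parcs G" "c u = c x"
  shows "x \<in> {u, v}"
proof -
  let ?N = "{y. (x, y) \<in> parcs G}"
  have "c ` ?N \<subseteq> C - {c x}"
    using C(2) harmonious_coloring_proper[OF harm, of x] by (force dest: in_arcsD2)
  moreover have "card (c ` ?N) = card (C - {c x})"
    using C x card_image[OF harmonious_inj_on_neighbours[OF harm, of x]] by auto
  ultimately have "c ` ?N = C - {c x}"
    using C(1) by (intro card_subset_eq) auto
  moreover have "c v \<in> C - {c x}"
    using C(2) uv harmonious_coloring_proper[OF harm uv(1)] by (auto dest: in_arcsD2)
  ultimately obtain w where w: "(x, w) \<in> parcs G" "c w = c v"
    by (metis (no_types, lifting) imageE mem_Collect_eq)
  have "{u, v} = {x, w}"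
    using harmonious_coloringD[OF harm uv(1) w(1)] w(2) uv(2) by simp
  then show ?thesis by blast
qed

section \<open>The lower bound\<close>

lemma tree_T_neighbours:
  "{y. (Spine 1, y) \<in> parcs (tree_T \<Delta>)} = insert (Spine 2) (Leaf 1 ` {..<\<Delta> - 1})"
  "{y. (Spine 2, y) \<in> parcs (tree_T \<Delta>)} = {Spine 1, Spine 3} \<union> Leaf 2 ` {..<\<Delta> - 2}"
  "{y. (Spine 4, y) \<in> parcs (tree_T \<Delta>)} = insert (Spine 3) (Leaf 4 ` {..<\<Delta> - 2})"
  by (auto simp: tree_T_def num_leaves_def)

lemma tree_T_degrees:
  assumes "\<Delta> \<ge> 2"
  shows "card {y. (Spine 1, y) \<in> parcs (tree_T \<Delta>)} = \<Delta>"
    "card {y. (Spine 2, y) \<in> parcs (tree_T \<Delta>)} = \<Delta>"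
    "card {y. (Spine 4, y) \<in> parcs (tree_T \<Delta>)} = \<Delta> - 1"
proof -
  have leaves: "card (Leaf i ` {..<n}) = n" for i n
    by (simp add: card_image inj_on_def)
  have "Spine k \<notin> Leaf i ` A" for k i A by auto
  then show "card {y. (Spine 1, y) \<in> parcs (tree_T \<Delta>)} = \<Delta>"
    "card {y. (Spine 2, y) \<in> parcs (tree_T \<Delta>)} = \<Delta>"
    "card {y. (Spine 4, y) \<in> parcs (tree_T \<Delta>)} = \<Delta> - 1"
    using assms unfolding tree_T_neighbours by (simp_all add: leaves)
qed

lemma tree_T_lower_bound:
  fixes c :: "tree_vertex \<Rightarrow> nat"
  assumes "\<Delta> \<ge> 2" and col: "c ` pverts (tree_T \<Delta>) \<subseteq> {..<\<Delta> + 1}"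
  shows "\<not> harmonious_coloring (tree_T \<Delta>) c"
proof
  assume harm: "harmonious_coloring (tree_T \<Delta>) c"
  interpret pair_graph "tree_T \<Delta>" by (rule pair_graph_tree_T)
  let ?N = "{y. (Spine 4, y) \<in> parcs (tree_T \<Delta>)}"
  have spine: "Spine 1 \<in> pverts (tree_T \<Delta>)" "Spine 2 \<in> pverts (tree_T \<Delta>)"
    "Spine 4 \<in> pverts (tree_T \<Delta>)"
    by (auto simp: tree_T_def)
  have only_at: "c u \<noteq> c (Spine i)"
    if "(u, v) \<in> parcs (tree_T \<Delta>)" "Spine i \<notin> {u, v}" "i = 1 \<or> i = 2" for u v i
    using saturated_vertex_incident[OF harm _ col, of "Spine i" u v] that spine
      tree_T_degrees[OF assms(1)] by auto
  have v3: "(Spine 4, Spine 3) \<in> parcs (tree_T \<Delta>)"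
    and v12: "(Spine 1, Spine 2) \<in> parcs (tree_T \<Delta>)"
    by (auto simp: tree_T_def)
  have avoid: "c y \<notin> {c (Spine 1), c (Spine 2), c (Spine 4)}" if "y \<in> ?N" for y
  proof -
    have y: "(Spine 4, y) \<in> parcs (tree_T \<Delta>)" "(y, Spine 4) \<in> parcs (tree_T \<Delta>)"
      using that by (auto simp: tree_T_def)
    have "Spine 1 \<notin> {y, Spine 4}" "Spine 2 \<notin> {y, Spine 4}"
      using that unfolding tree_T_neighbours by auto
    then show ?thesis
      using only_at[OF y(2)] harmonious_coloring_proper[OF harm y(1)] by auto
  qed
  have distinct: "card {c (Spine 1), c (Spine 2), c (Spine 4)} = 3"
    using only_at[OF v3, of 1] only_at[OF v3, of 2] harmonious_coloring_proper[OF harm v12]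
    by simp
  have "c ` ?N \<subseteq> {..<\<Delta> + 1} - {c (Spine 1), c (Spine 2), c (Spine 4)}"
    using col avoid by (force dest: in_arcsD2)
  then have "card (c ` ?N) \<le> card ({..<\<Delta> + 1} - {c (Spine 1), c (Spine 2), c (Spine 4)})"
    by (intro card_mono) auto
  also have "\<dots> = \<Delta> + 1 - 3"
    using col spine distinct by (subst card_Diff_subset) auto
  finally have "\<Delta> - 1 \<le> \<Delta> + 1 - 3"
    using card_image[OF harmonious_inj_on_neighbours[OF harm, of "Spine 4"]]
      tree_T_degrees(3)[OF assms(1)] by simp
  then show False using assms(1) by simp
qed

section \<open>The upper bound\<close>

text \<open>
  The vertices \<open>v\<^sub>1\<close>, \<open>v\<^sub>2\<close>, \<open>v\<^sub>3\<close>, \<open>v\<^sub>4\<close> get \<open>0\<close>, \<open>1\<close>, \<open>\<Delta> + 1\<close>, \<open>2\<close>. The leaves at \<open>v\<^sub>4\<close> start one colour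
  higher, at \<open>3\<close>, to avoid the colour of \<open>v\<^sub>4\<close>, and therefore end at \<open>\<Delta>\<close>, just below that
  of \<open>v\<^sub>3\<close>.
\<close>

fun tree_T_coloring :: "nat \<Rightarrow> tree_vertex \<Rightarrow> nat" where
  "tree_T_coloring \<Delta> (Spine i) = (if i = 1 then 0 else if i = 2 then 1 else
     if i = 3 then \<Delta> + 1 else 2)"
| "tree_T_coloring \<Delta> (Leaf i j) = (if i = 4 then j + 3 else j + 2)"

lemma tree_T_coloring_range:
  assumes "\<Delta> \<ge> 1"
  shows "tree_T_coloring \<Delta> ` pverts (tree_T \<Delta>) \<subseteq> {..<\<Delta> + 2}"
  using assms by (auto simp: tree_T_def num_leaves_def split: if_splits)

lemma tree_T_coloring_inj_on_neighbours:
  assumes "\<Delta> \<ge> 2" "x \<in> {Spine 1, Spine 2, Spine 4}"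
  shows "inj_on (tree_T_coloring \<Delta>) {y. (x, y) \<in> parcs (tree_T \<Delta>)}"
proof -
  have "inj_on (tree_T_coloring \<Delta>) {y. (Spine 1, y) \<in> parcs (tree_T \<Delta>)}"
    unfolding tree_T_neighbours using assms(1) by (auto simp: inj_on_def)
  moreover have "inj_on (tree_T_coloring \<Delta>) {y. (Spine 2, y) \<in> parcs (tree_T \<Delta>)}"
    unfolding tree_T_neighbours using assms(1) by (auto simp: inj_on_def)
  moreover have "inj_on (tree_T_coloring \<Delta>) {y. (Spine 4, y) \<in> parcs (tree_T \<Delta>)}"
    unfolding tree_T_neighbours using assms(1) by (auto simp: inj_on_def)
  ultimately show ?thesis using assms(2) by blast
qed

text \<open>
  If each edge is oriented towards its larger colour, then unordered pairs of colours agree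
  iff the ordered ones do.
\<close>

lemma harmonious_coloring_orientedI:
  fixes c :: "'a \<Rightarrow> 'c :: linorder"
  assumes E: "parcs G = E \<union> E\<inverse>"
    and less: "\<And>x y. (x, y) \<in> E \<Longrightarrow> c x < c y"
    and inj: "\<And>x y x' y'. (x, y) \<in> E \<Longrightarrow> (x', y') \<in> E \<Longrightarrow> c x = c x' \<Longrightarrow> c y = c y'
      \<Longrightarrow> x = x' \<and> y = y'"
  shows "harmonious_coloring G c"
proof -
  have edge: "\<exists>a b. (a, b) \<in> E \<and> {a, b} = {x, y} \<and> {c a, c b} = {c x, c y}"
    if "(x, y) \<in> parcs G" for x y
    using that E by blast
  have "c x \<noteq> c y" if "(x, y) \<in> parcs G" for x y
    using that E less by fastforce
  moreover have "{x, y} = {x', y'}"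
    if xy: "(x, y) \<in> parcs G" "(x', y') \<in> parcs G" and eq: "{c x, c y} = {c x', c y'}" for x y x' y'
  proof -
    obtain a b where ab: "(a, b) \<in> E" "{a, b} = {x, y}" "{c a, c b} = {c x, c y}"
      using edge[OF xy(1)] by blast
    obtain a' b' where ab': "(a', b') \<in> E" "{a', b'} = {x', y'}" "{c a', c b'} = {c x', c y'}"
      using edge[OF xy(2)] by blast
    have "{c a, c b} = {c a', c b'}" using ab(3) ab'(3) eq by simp
    then have "c a = c a' \<and> c b = c b'"
      using less[OF ab(1)] less[OF ab'(1)] by (auto simp: doubleton_eq_iff)
    then show ?thesis using inj[OF ab(1) ab'(1)] ab(2) ab'(2) by simp
  qed
  ultimately show ?thesis
    unfolding harmonious_coloring_def proper_coloring_def by blast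
qed

lemma tree_T_coloring_harmonious:
  assumes "\<Delta> \<ge> 2"
  shows "harmonious_coloring (tree_T \<Delta>) (tree_T_coloring \<Delta>)"
proof (rule harmonious_coloring_orientedI)
  \<comment> \<open>The end of \<open>v\<^sub>3v\<^sub>4\<close> with the smaller colour is \<open>v\<^sub>4\<close>, so every arc starts at \<open>v\<^sub>1\<close>, \<open>v\<^sub>2\<close> or \<open>v\<^sub>4\<close>.\<close>
  let ?E = "{(Spine 1, Spine 2), (Spine 2, Spine 3), (Spine 4, Spine 3)}
    \<union> {(Spine i, Leaf i j) | i j. i \<in> {1..4} \<and> j < num_leaves \<Delta> i}"
  show E: "parcs (tree_T \<Delta>) = ?E \<union> ?E\<inverse>"
    unfolding tree_T_def Let_def by auto
  have arcs: "(x, y) \<in> parcs (tree_T \<Delta>)" if "(x, y) \<in> ?E" for x y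
    unfolding E using that by (rule UnI1)
  show "tree_T_coloring \<Delta> x < tree_T_coloring \<Delta> y" if "(x, y) \<in> ?E" for x y
    using that assms by (auto simp: num_leaves_def split: if_splits)
  show "x = x' \<and> y = y'"
    if xy: "(x, y) \<in> ?E" "(x', y') \<in> ?E"
      and eq: "tree_T_coloring \<Delta> x = tree_T_coloring \<Delta> x'" "tree_T_coloring \<Delta> y = tree_T_coloring \<Delta> y'"
    for x y x' y'
  proof -
    have start: "z \<in> {Spine 1, Spine 2, Spine 4}" if "(z, w) \<in> ?E" for z w
      using that by (auto simp: num_leaves_def split: if_splits)
    have x: "x = x'"
      using start[OF xy(1)] start[OF xy(2)] eq(1) by auto
    have "y = y'"
      using inj_onD[OF tree_T_coloring_inj_on_neighbours[OF assms start[OF xy(1)]] eq(2)]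
        arcs[OF xy(1)] arcs[OF xy(2)] unfolding x by blast
    with x show ?thesis by blast
  qed
qed

section \<open>The harmonious chromatic number\<close>

theorem claim2:
  fixes \<Delta> :: nat
  assumes "\<Delta> \<ge> 3"
  shows "harmonious_chromatic_number (tree_T \<Delta>) = \<Delta> + 2"
  unfolding harmonious_chromatic_number_def
proof (rule Least_equality)
  show "\<exists>c :: tree_vertex \<Rightarrow> nat.
      c ` pverts (tree_T \<Delta>) \<subseteq> {..<\<Delta> + 2} \<and> harmonious_coloring (tree_T \<Delta>) c"
    using tree_T_coloring_range[of \<Delta>] tree_T_coloring_harmonious[of \<Delta>] assms
      by (intro exI[of _ "tree_T_coloring \<Delta>"] conjI) simp_all
next
  fix k
  assume "\<exists>c :: tree_vertex \<Rightarrow> nat.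
      c ` pverts (tree_T \<Delta>) \<subseteq> {..<k} \<and> harmonious_coloring (tree_T \<Delta>) c"
  then obtain c :: "tree_vertex \<Rightarrow> nat"
    where c: "c ` pverts (tree_T \<Delta>) \<subseteq> {..<k}" "harmonious_coloring (tree_T \<Delta>) c"
    by blast
  show "\<Delta> + 2 \<le> k"
  proof (rule ccontr)
    assume "\<not> \<Delta> + 2 \<le> k"
    then have "{..<k} \<subseteq> {..<\<Delta> + 1}" by auto
    then have "c ` pverts (tree_T \<Delta>) \<subseteq> {..<\<Delta> + 1}"
      using c(1) by (rule subset_trans[rotated])
    then show False
      using tree_T_lower_bound[of \<Delta> c] c(2) assms by simp
  qed
qed

end
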